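(* Let $R$ be an integral domain such that $R/(m)$ is finite for every $m\in R\setminus\{0\}$, and let $K$ be its field of fractions. The partial action $\theta$ of $K\rtimes K^\times$ on $\hat R_K$ (described in the context) is minimal.
   Context: An integral domain is a unital commutative ring without zero divisors. $K^\times=K\setminus\{0\}$. The group $K\rtimes K^\times$ consists of pairs $(u,w)$, $u\in K$, $w\in K^\times$, with $(u,w)(u',w')=(u+u'w,ww')$, $(u,w)^{-1}=(-u/w,1/w)$ and identity $(0,1)$. The ring $\hat R_K$. For $w,w'\in K^\times$ write $w\le w'$ if $w'=wr$ for some $r\in R$, and let $(w)=wR\subseteq K$. If $w\le w'$ let $p_{w,w'}:(R+(w'))/(w')\to(R+(w))/(w)$ be the canonical projection. Then $$\hat R_K=\Big\{(u_w+(w))_w\in\prod_{w\in K^\times}(R+(w))/(w) : p_{w,w'}(u_{w'}+(w'))=u_w+(w)\text{ whenever } w\le w'\Big\},$$ with the topology induced by the product topology, each $(R+(w))/(w)$ being discrete; it is a compact Hausdorff space. The partial action $\theta$ of $K\rtimes K^\times$ on $\hat R_K$. For $(u,w)\in K\rtimes K^\times$, $\hat R_{(u,w)}=\{(u_{w'}+(w'))_{w'}\in\hat R_K : u_w+(w)=u+(w)\}$ (equality of cosets in $K$; a clopen set), and $\theta_{(u,w)}:\hat R_{(u,w)^{-1}}\to\hat R_{(u,w)}$ is the homeomorphism $\theta_{(u,w)}((u_{w'}+(w'))_{w'})=(u+wu_{w^{-1}w'}+(w'))_{w'}$. For a partial action $\theta=(\theta_g:X_{g^{-1}}\to X_g)_{g\in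 G}$ of a discrete group $G$ on a space $X$, a subset $V\subseteq X$ is invariant if $\theta_g(V\cap X_{g^{-1}})\subseteq V$ for every $g\in G$. The partial action is minimal if there are no invariant open subsets of $X$ other than $\emptyset$ and $X$; equivalently, every $x\in X$ has dense orbit $\{\theta_g(x) : g\in G,\ x\in X_{g^{-1}}\}$. *)

theory Defs
  imports "HOL-Analysis.Abstract_Topology" "HOL-Analysis.Function_Topology" "HOL-Algebra.Group"
    "HOL-Computational_Algebra.Fraction_Field"
begin

section \<open>Partial actions of discrete groups\<close>

text \<open>The map \<open>\<theta> g\<close> is only meaningful on its domain \<open>X (inv\<^bsub>G\<^esub> g)\<close>;
  the values of \<open>\<theta> g\<close> elsewhere, and of \<open>X\<close> and \<open>\<theta>\<close> outside \<open>carrier G\<close>, play no role.\<close>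

definition partial_action ::
    "('g, 'm) monoid_scheme \<Rightarrow> 'x topology \<Rightarrow> ('g \<Rightarrow> 'x set) \<Rightarrow> ('g \<Rightarrow> 'x \<Rightarrow> 'x) \<Rightarrow> bool" where
  "partial_action G T X \<theta> \<longleftrightarrow>
     group G \<and>
     (\<forall>g\<in>carrier G. openin T (X g)) \<and>
     (\<forall>g\<in>carrier G. homeomorphic_map (subtopology T (X (inv\<^bsub>G\<^esub> g))) (subtopology T (X g)) (\<theta> g)) \<and>
     X \<one>\<^bsub>G\<^esub> = topspace T \<and>
     (\<forall>x\<in>topspace T. \<theta> \<one>\<^bsub>G\<^esub> x = x) \<and>
     (\<forall>g\<in>carrier G. \<forall>h\<in>carrier G. \<forall>x\<in>X (inv\<^bsub>G\<^esub> h).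
        \<theta> h x \<in> X (inv\<^bsub>G\<^esub> g) \<longrightarrow>
          x \<in> X (inv\<^bsub>G\<^esub> (g \<otimes>\<^bsub>G\<^esub> h)) \<and> \<theta> g (\<theta> h x) = \<theta> (g \<otimes>\<^bsub>G\<^esub> h) x)"

definition pa_invariant ::
    "('g, 'm) monoid_scheme \<Rightarrow> ('g \<Rightarrow> 'x set) \<Rightarrow> ('g \<Rightarrow> 'x \<Rightarrow> 'x) \<Rightarrow> 'x set \<Rightarrow> bool" where
  "pa_invariant G X \<theta> V \<longleftrightarrow> (\<forall>g\<in>carrier G. \<theta> g ` (V \<inter> X (inv\<^bsub>G\<^esub> g)) \<subseteq> V)"

definition pa_minimal ::
    "('g, 'm) monoid_scheme \<Rightarrow> 'x topology \<Rightarrow> ('g \<Rightarrow> 'x set) \<Rightarrow> ('g \<Rightarrow> 'x \<Rightarrow> 'x) \<Rightarrow> bool" where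
  "pa_minimal G T X \<theta> \<longleftrightarrow>
     (\<forall>V. openin T V \<and> pa_invariant G X \<theta> V \<longrightarrow> V = {} \<or> V = topspace T)"


section \<open>The group \<open>K \<rtimes> K\<^sup>\<times>\<close>\<close>

abbreviation units_of_field :: "'k::field set" where
  "units_of_field \<equiv> UNIV - {0}"

definition affine_group :: "('k::field \<times> 'k) monoid" where
  "affine_group =
     \<lparr> carrier = UNIV \<times> units_of_field,
       mult = (\<lambda>(u, w) (u', w'). (u + u' * w, w * w')),
       one = (0, 1) \<rparr>"


section \<open>The space \<open>R\<^sub>K\<close>-hat\<close>

text \<open>The ring \<open>R\<close> is the type \<open>'a::idom\<close> and \<open>K\<close> is its field of fractions \<open>'a fract\<close>.\<close>

definition base_ring :: "'a::idom fract set" where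
  "base_ring = range (\<lambda>r. Fraction_Field.Fract r 1)"

definition frac_ideal :: "'a::idom fract \<Rightarrow> 'a fract set" where
  "frac_ideal w = {w * r | r. r \<in> base_ring}"

definition div_le :: "'a::idom fract \<Rightarrow> 'a fract \<Rightarrow> bool" where
  "div_le w w' \<longleftrightarrow> (\<exists>r\<in>base_ring. w' = w * r)"

definition frac_coset :: "'a::idom fract \<Rightarrow> 'a fract \<Rightarrow> 'a fract set" where
  "frac_coset u w = {u + z | z. z \<in> frac_ideal w}"

text \<open>The quotient \<open>(R + (w)) / (w)\<close>, as a set of cosets in \<open>K\<close>.\<close>

definition frac_quot :: "'a::idom fract \<Rightarrow> 'a fract set set" where
  "frac_quot w = {frac_coset (r + z) w | r z. r \<in> base_ring \<and> z \<in> frac_ideal w}"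

text \<open>The canonical projection \<open>u + (w') \<mapsto> u + (w)\<close> takes a coset \<open>C\<close> of \<open>(w')\<close> to \<open>C + (w)\<close>;
  it is used only for \<open>div_le w w'\<close>, i.e. \<open>(w') \<subseteq> (w)\<close>.\<close>

definition frac_proj :: "'a::idom fract \<Rightarrow> 'a fract \<Rightarrow> 'a fract set \<Rightarrow> 'a fract set" where
  "frac_proj w w' C = {c + z | c z. c \<in> C \<and> z \<in> frac_ideal w}"

definition rhat :: "('a::idom fract \<Rightarrow> 'a fract set) set" where
  "rhat = {x \<in> \<Pi>\<^sub>E w\<in>units_of_field. frac_quot w.
             \<forall>w\<in>units_of_field. \<forall>w'\<in>units_of_field. div_le w w' \<longrightarrow> frac_proj w w' (x w') = x w}"

definition rhat_top :: "('a::idom fract \<Rightarrow> 'a fract set) topology" where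
  "rhat_top = subtopology
     (product_topology (\<lambda>w. discrete_topology (frac_quot w)) units_of_field) rhat"


section \<open>The partial action\<close>

definition rhat_dom :: "'a::idom fract \<times> 'a fract \<Rightarrow> ('a fract \<Rightarrow> 'a fract set) set" where
  "rhat_dom = (\<lambda>(u, w). {x \<in> rhat. x w = frac_coset u w})"

text \<open>If \<open>x (w\<^sup>-\<^sup>1 w') = v + (w\<^sup>-\<^sup>1 w')\<close>, then its image under \<open>z \<mapsto> u + w z\<close> is \<open>u + w v + (w')\<close>;
  taking the image of the whole coset avoids choosing the representative \<open>v\<close>.\<close>

definition rhat_act :: "'a::idom fract \<times> 'a fract \<Rightarrow>
    ('a fract \<Rightarrow> 'a fract set) \<Rightarrow> ('a fract \<Rightarrow> 'a fract set)" where
  "rhat_act = (\<lambda>(u, w) x. \<lambda>w'\<in>units_of_field. (\<lambda>z. u + w * z) ` x (inverse w * w'))"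


section \<open>Basic facts\<close>

lemma group_affine_group: "group (affine_group :: ('k::field \<times> 'k) monoid)"
proof (rule groupI)
  fix x :: "'k \<times> 'k" assume "x \<in> carrier affine_group"
  then show "\<exists>y\<in>carrier affine_group. y \<otimes>\<^bsub>affine_group\<^esub> x = \<one>\<^bsub>affine_group\<^esub>"
    by (intro bexI[of _ "(- fst x / snd x, 1 / snd x)"])
       (auto simp: affine_group_def field_simps)
qed (auto simp: affine_group_def field_simps)

lemma inv_affine_group:
  assumes "w \<noteq> (0::'k::field)"
  shows "inv\<^bsub>affine_group\<^esub> (u, w) = (- u / w, 1 / w)"
proof -
  interpret group "affine_group :: ('k \<times> 'k) monoid" by (rule group_affine_group)
  show ?thesis
    by (rule inv_equality) (use assms in \<open>auto simp: affine_group_def field_simps\<close>)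
qed

lemma base_ring_closed:
  "0 \<in> base_ring" "1 \<in> base_ring"
  "a \<in> base_ring \<Longrightarrow> b \<in> base_ring \<Longrightarrow> a + b \<in> base_ring"
  "a \<in> base_ring \<Longrightarrow> b \<in> base_ring \<Longrightarrow> a * b \<in> base_ring"
  "a \<in> base_ring \<Longrightarrow> - a \<in> base_ring"
  "a \<in> base_ring \<Longrightarrow> b \<in> base_ring \<Longrightarrow> a - b \<in> base_ring"
  by (auto simp: base_ring_def Zero_fract_def One_fract_def image_iff)

lemma frac_ideal_closed:
  "0 \<in> frac_ideal w"
  "a \<in> frac_ideal w \<Longrightarrow> b \<in> frac_ideal w \<Longrightarrow> a + b \<in> frac_ideal w"
  "a \<in> frac_ideal w \<Longrightarrow> - a \<in> frac_ideal w"
  "a \<in> frac_ideal w \<Longrightarrow> b \<in> frac_ideal w \<Longrightarrow> a - b \<in> frac_ideal w"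
proof -
  show "0 \<in> frac_ideal w"
    unfolding frac_ideal_def using base_ring_closed(1) by force
  show "a + b \<in> frac_ideal w" if "a \<in> frac_ideal w" "b \<in> frac_ideal w"
    using that base_ring_closed(3) unfolding frac_ideal_def by (force simp: distrib_left[symmetric])
  show "- a \<in> frac_ideal w" if "a \<in> frac_ideal w"
    using that base_ring_closed(5) unfolding frac_ideal_def by (force simp flip: mult_minus_right)
  show "a - b \<in> frac_ideal w" if "a \<in> frac_ideal w" "b \<in> frac_ideal w"
    using that base_ring_closed(6) unfolding frac_ideal_def
    by (force simp: right_diff_distrib[symmetric])
qed

lemma mem_frac_coset: "z \<in> frac_coset u w \<longleftrightarrow> z - u \<in> frac_ideal w"
  by (auto simp: frac_coset_def) (metis add_diff_cancel_left' diff_add_cancel add.commute)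

lemma frac_coset_self: "u \<in> frac_coset u w"
  by (simp add: mem_frac_coset frac_ideal_closed)

lemma frac_coset_eq_iff: "frac_coset u w = frac_coset v w \<longleftrightarrow> u - v \<in> frac_ideal w"
proof
  assume "frac_coset u w = frac_coset v w"
  then show "u - v \<in> frac_ideal w" using frac_coset_self[of u w] mem_frac_coset by blast
next
  assume a: "u - v \<in> frac_ideal w"
  have "z - u \<in> frac_ideal w \<longleftrightarrow> z - v \<in> frac_ideal w" for z
    using frac_ideal_closed(2)[OF a, of "z - u"] frac_ideal_closed(4)[of "z - v" w "u - v"] a
    by auto
  then show "frac_coset u w = frac_coset v w" by (auto simp: mem_frac_coset)
qed

lemma frac_ideal_mult:
  assumes "w \<noteq> 0"
  shows "w * z \<in> frac_ideal w' \<longleftrightarrow> z \<in> frac_ideal (inverse w * w')"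
  using assms unfolding frac_ideal_def by (auto simp: field_simps)

lemma frac_ideal_mono: "div_le w w' \<Longrightarrow> frac_ideal w' \<subseteq> frac_ideal w"
  unfolding div_le_def frac_ideal_def
  by (auto simp: mult.assoc) (metis base_ring_closed(4))

lemma affine_image_frac_coset:
  assumes "w \<noteq> 0"
  shows "(\<lambda>z. u + w * z) ` frac_coset v (inverse w * w') = frac_coset (u + w * v) w'"
proof (intro Set.set_eqI iffI)
  fix y assume "y \<in> (\<lambda>z. u + w * z) ` frac_coset v (inverse w * w')"
  then obtain z where z: "y = u + w * z" "z - v \<in> frac_ideal (inverse w * w')"
    by (metis (no_types, lifting) imageE mem_frac_coset)
  then have "w * (z - v) \<in> frac_ideal w'" using frac_ideal_mult[OF assms] by blast
  then show "y \<in> frac_coset (u + w * v) w'"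
    unfolding mem_frac_coset z(1) by (simp add: algebra_simps)
next
  fix y assume "y \<in> frac_coset (u + w * v) w'"
  then have y: "y - (u + w * v) \<in> frac_ideal w'" by (simp add: mem_frac_coset)
  define z where "z = (y - u) / w"
  have yz: "y = u + w * z" using assms by (simp add: z_def)
  have "w * (z - v) \<in> frac_ideal w'" using y unfolding yz by (simp add: algebra_simps)
  then have "z \<in> frac_coset v (inverse w * w')"
    using frac_ideal_mult[OF assms] by (simp add: mem_frac_coset)
  then show "y \<in> (\<lambda>z. u + w * z) ` frac_coset v (inverse w * w')" using yz by blast
qed

lemma frac_proj_frac_coset:
  assumes "div_le w w'"
  shows "frac_proj w w' (frac_coset u w') = frac_coset u w"
proof (intro Set.set_eqI iffI)
  fix y assume "y \<in> frac_proj w w' (frac_coset u w')"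
  then obtain c z where "y = c + z" "c - u \<in> frac_ideal w'" "z \<in> frac_ideal w"
    by (auto simp: frac_proj_def mem_frac_coset)
  then show "y \<in> frac_coset u w"
    using frac_ideal_mono[OF assms] frac_ideal_closed(2)[of "c - u" w z]
    by (auto simp: mem_frac_coset algebra_simps)
next
  fix y assume "y \<in> frac_coset u w"
  then show "y \<in> frac_proj w w' (frac_coset u w')"
    using frac_coset_self[of u w'] unfolding frac_proj_def frac_coset_def[of u w] by blast
qed

lemma frac_quot_eq: "frac_quot w = (\<lambda>r. frac_coset r w) ` base_ring"
proof -
  have "frac_coset (r + z) w = frac_coset r w" if "z \<in> frac_ideal w" for r z
    using that by (simp add: frac_coset_eq_iff)
  then show ?thesis
    unfolding frac_quot_def by (auto simp: image_iff) (metis add_0_right frac_ideal_closed(1))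
qed

lemma div_le_directed:
  assumes "w \<noteq> 0" "w' \<noteq> 0"
  obtains t where "t \<noteq> 0" "div_le w t" "div_le w' t"
proof -
  obtain a b where ab: "w = Fraction_Field.Fract a b" "b \<noteq> 0" by (cases w) auto
  obtain c d where cd: "w' = Fraction_Field.Fract c d" "d \<noteq> 0" by (cases w') auto
  have nz: "a \<noteq> 0" "c \<noteq> 0"
    using assms ab cd by (auto simp: fract_collapse)
  let ?t = "Fraction_Field.Fract (a * c) 1"
  have "?t \<noteq> 0" using nz by (simp add: Zero_fract_def eq_fract)
  moreover have "?t = w * Fraction_Field.Fract (b * c) 1"
    using ab by (simp add: eq_fract algebra_simps)
  moreover have "?t = w' * Fraction_Field.Fract (a * d) 1"
    using cd by (simp add: eq_fract algebra_simps)
  ultimately show ?thesis using that unfolding div_le_def base_ring_def by blast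
qed

lemma rhatD:
  assumes "x \<in> rhat"
  shows "w \<noteq> 0 \<Longrightarrow> \<exists>r\<in>base_ring. x w = frac_coset r w"
    and "w \<noteq> 0 \<Longrightarrow> w' \<noteq> 0 \<Longrightarrow> div_le w w' \<Longrightarrow> x w' = frac_coset r w' \<Longrightarrow> x w = frac_coset r w"
    and "x 0 = undefined"
proof -
  show "\<exists>r\<in>base_ring. x w = frac_coset r w" if "w \<noteq> 0"
  proof -
    have "x w \<in> (\<lambda>r. frac_coset r w) ` base_ring"
      using assms that unfolding rhat_def frac_quot_eq by (auto simp: PiE_iff)
    then show ?thesis by blast
  qed
  show "x w = frac_coset r w" if "w \<noteq> 0" "w' \<noteq> 0" "div_le w w'" "x w' = frac_coset r w'"
  proof -
    have "frac_proj w w' (x w') = x w" using assms that(1-3) unfolding rhat_def by blast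
    then show ?thesis using frac_proj_frac_coset[OF that(3), of r] that(4) by simp
  qed
  show "x 0 = undefined"
    using assms unfolding rhat_def by (auto simp: PiE_iff extensional_def)
qed

lemma rhat_act_apply:
  assumes "w \<noteq> 0" "w' \<noteq> 0" "x (inverse w * w') = frac_coset v (inverse w * w')"
  shows "rhat_act (u, w) x w' = frac_coset (u + w * v) w'"
  using assms by (simp add: rhat_act_def affine_image_frac_coset)

lemma topspace_rhat_top: "topspace rhat_top = rhat"
  by (auto simp: rhat_top_def rhat_def)

lemma rhat_act_mem:
  assumes w: "w \<noteq> 0" and x: "x \<in> rhat_dom (- u / w, 1 / w)"
  shows "rhat_act (u, w) x \<in> rhat_dom (u, w)"
proof -
  have xr: "x \<in> rhat" and x1: "x (1 / w) = frac_coset (- u / w) (1 / w)"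
    using x by (auto simp: rhat_dom_def)
  have quot: "rhat_act (u, w) x w' \<in> frac_quot w'" if w': "w' \<noteq> 0" for w'
  proof -
    have v: "inverse w * w' \<noteq> 0" "1 / w \<noteq> 0" using w w' by auto
    obtain t where t: "t \<noteq> 0" "div_le (1 / w) t" "div_le (inverse w * w') t"
      using div_le_directed[OF v(2,1)] by blast
    obtain c where c: "x t = frac_coset c t" using rhatD(1)[OF xr t(1)] by blast
    have "x (1 / w) = frac_coset c (1 / w)" using rhatD(2)[OF xr v(2) t(1,2) c] .
    then have "c - - u / w \<in> frac_ideal (inverse w * 1)"
      using x1 by (metis frac_coset_eq_iff inverse_eq_divide mult.right_neutral)
    then have "w * (c - - u / w) \<in> frac_ideal 1" using frac_ideal_mult[OF w] by blast
    moreover have "w * (c - - u / w) = u + w * c" using w by (simp add: distrib_left)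
    ultimately have r: "u + w * c \<in> base_ring" by (simp add: frac_ideal_def)
    have "x (inverse w * w') = frac_coset c (inverse w * w')"
      using rhatD(2)[OF xr v(1) t(1,3) c] .
    then show ?thesis using rhat_act_apply[where u = u] w w' r unfolding frac_quot_eq by blast
  qed
  have "frac_proj w1 w2 (rhat_act (u, w) x w2) = rhat_act (u, w) x w1"
    if h: "w1 \<noteq> 0" "w2 \<noteq> 0" "div_le w1 w2" for w1 w2
  proof -
    obtain c where c: "x (inverse w * w2) = frac_coset c (inverse w * w2)"
      using rhatD(1)[OF xr, of "inverse w * w2"] w h by auto
    have "div_le (inverse w * w1) (inverse w * w2)"
      using h(3) by (auto simp: div_le_def mult.assoc)
    then have "x (inverse w * w1) = frac_coset c (inverse w * w1)"
      using rhatD(2)[OF xr _ _ _ c] w h by auto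
    then show ?thesis
      using c rhat_act_apply[where u = u and x = x] w h frac_proj_frac_coset[OF h(3)] by simp
  qed
  then have "rhat_act (u, w) x \<in> rhat"
    using quot by (auto simp: rhat_def PiE_iff) (auto simp: rhat_act_def)
  moreover have "rhat_act (u, w) x w = frac_coset u w"
  proof -
    have "x (inverse w * w) = frac_coset 0 (inverse w * w)"
    proof -
      obtain r where r: "r \<in> base_ring" "x 1 = frac_coset r 1" using rhatD(1)[OF xr, of 1] by auto
      moreover have "frac_coset r 1 = frac_coset 0 1"
        using r(1) by (simp add: frac_coset_eq_iff frac_ideal_def)
      ultimately show ?thesis using w by simp
    qed
    then show ?thesis using rhat_act_apply[OF w w, of x 0 u] by simp
  qed
  ultimately show ?thesis by (simp add: rhat_dom_def)
qed

lemma rhat_act_compose: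
  assumes "w1 \<noteq> 0" "w2 \<noteq> 0" "x \<in> rhat"
  shows "rhat_act (u1, w1) (rhat_act (u2, w2) x) = rhat_act (u1 + u2 * w1, w1 * w2) x"
proof
  fix w'
  show "rhat_act (u1, w1) (rhat_act (u2, w2) x) w' = rhat_act (u1 + u2 * w1, w1 * w2) x w'"
    using assms by (cases "w' = 0") (auto simp: rhat_act_def image_image algebra_simps)
qed

lemma rhat_act_one:
  assumes "x \<in> rhat" shows "rhat_act (0, 1) x = x"
proof
  fix w'
  show "rhat_act (0, 1) x w' = x w'"
    using rhatD(3)[OF assms] by (cases "w' = 0") (auto simp: rhat_act_def)
qed

lemma openin_rhat_dom:
  assumes "w \<noteq> 0" shows "openin rhat_top (rhat_dom (u, w))"
proof -
  have "openin (product_topology (\<lambda>w. discrete_topology (frac_quot w)) units_of_field)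
      {x \<in> topspace (product_topology (\<lambda>w. discrete_topology (frac_quot w)) units_of_field).
        x w \<in> {frac_coset u w} \<inter> frac_quot w}" (is "openin ?T ?U")
    by (rule openin_continuous_map_preimage[OF continuous_map_product_projection])
       (use assms in auto)
  moreover have "rhat_dom (u, w) = ?U \<inter> rhat"
    using assms by (auto simp: rhat_dom_def rhat_def PiE_iff)
  ultimately show ?thesis unfolding rhat_top_def openin_subtopology by blast
qed

lemma continuous_rhat_act:
  assumes w: "w \<noteq> 0"
  shows "continuous_map (subtopology rhat_top (rhat_dom (- u / w, 1 / w)))
           (subtopology rhat_top (rhat_dom (u, w))) (rhat_act (u, w))"
proof -
  let ?P = "product_topology (\<lambda>w. discrete_topology (frac_quot w)) units_of_field"
  let ?D = "rhat_dom (- u / w, 1 / w)" and ?E = "rhat_dom (u, w)"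
  have sub: "?D \<subseteq> rhat" "?E \<subseteq> rhat" by (auto simp: rhat_dom_def)
  have eq: "subtopology rhat_top ?D = subtopology ?P ?D" "subtopology rhat_top ?E = subtopology ?P ?E"
    using sub by (simp_all add: rhat_top_def subtopology_subtopology Int_absorb1)
  have tsD: "topspace (subtopology ?P ?D) = ?D"
    using sub by (auto simp: rhat_def)
  have img: "rhat_act (u, w) ` ?D \<subseteq> ?E" using rhat_act_mem[OF w] by blast
  have comp: "continuous_map (subtopology ?P ?D) (discrete_topology (frac_quot w'))
      (\<lambda>x. rhat_act (u, w) x w')" if w': "w' \<in> units_of_field" for w'
  proof -
    have v: "inverse w * w' \<in> units_of_field" using w w' by auto
    let ?Q = "discrete_topology (frac_quot (inverse w * w'))"
    have p: "continuous_map (subtopology ?P ?D) ?Q (\<lambda>x. x (inverse w * w'))"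
      by (intro continuous_map_from_subtopology continuous_map_product_projection[OF v])
    show ?thesis
    proof (unfold continuous_map_def, intro conjI allI impI funcsetI)
      fix x assume "x \<in> topspace (subtopology ?P ?D)"
      then have "rhat_act (u, w) x \<in> rhat" using img sub unfolding tsD by blast
      then show "rhat_act (u, w) x w' \<in> topspace (discrete_topology (frac_quot w'))"
        using w' by (auto simp: rhat_def PiE_iff)
    next
      fix U assume "openin (discrete_topology (frac_quot w')) U"
      let ?V = "{C \<in> frac_quot (inverse w * w'). (\<lambda>z. u + w * z) ` C \<in> U}"
      have "openin (subtopology ?P ?D) {x \<in> topspace (subtopology ?P ?D). x (inverse w * w') \<in> ?V}"
        by (rule openin_continuous_map_preimage[OF p]) auto
      moreover have "{x \<in> topspace (subtopology ?P ?D). rhat_act (u, w) x w' \<in> U} =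
          {x \<in> topspace (subtopology ?P ?D). x (inverse w * w') \<in> ?V}"
        using w' v by (auto simp: rhat_act_def PiE_iff)
      ultimately show "openin (subtopology ?P ?D)
          {x \<in> topspace (subtopology ?P ?D). rhat_act (u, w) x w' \<in> U}" by simp
    qed
  qed
  have "continuous_map (subtopology ?P ?D) ?P (rhat_act (u, w))"
    unfolding continuous_map_componentwise
    using comp by (auto simp: rhat_act_def)
  then show ?thesis
    unfolding eq continuous_map_in_subtopology using img unfolding tsD by auto
qed

text \<open>The data above indeed form a partial action; finiteness of the quotients of \<open>R\<close>
  is not needed for this.\<close>

lemma partial_action_rhat:
  "partial_action (affine_group :: ('a::idom fract \<times> 'a fract) monoid) rhat_top rhat_dom rhat_act"
proof -
  let ?G = "affine_group :: ('a fract \<times> 'a fract) monoid"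
  have car: "(u, w) \<in> carrier ?G \<longleftrightarrow> w \<noteq> 0" for u w by (simp add: affine_group_def)
  have one: "\<one>\<^bsub>?G\<^esub> = (0, 1)" by (simp add: affine_group_def)
  have mul: "(u, w) \<otimes>\<^bsub>?G\<^esub> (u', w') = (u + u' * w, w * w')" for u w u' w'
    by (simp add: affine_group_def)
  have dom1: "rhat_dom (0, 1) = (rhat :: ('a fract \<Rightarrow> 'a fract set) set)"
  proof -
    have "x 1 = frac_coset 0 1" if xr: "x \<in> rhat" for x :: "'a fract \<Rightarrow> 'a fract set"
    proof -
      obtain r where r: "r \<in> base_ring" "x 1 = frac_coset r 1"
        using rhatD(1)[OF xr, of 1] by auto
      moreover have "frac_coset r 1 = frac_coset 0 1"
        using r(1) by (simp add: frac_coset_eq_iff frac_ideal_def)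
      ultimately show ?thesis by simp
    qed
    then show ?thesis by (auto simp: rhat_dom_def)
  qed
  have homeo: "homeomorphic_map (subtopology rhat_top (rhat_dom (- u / w, 1 / w)))
      (subtopology rhat_top (rhat_dom (u, w))) (rhat_act (u, w))" if w: "w \<noteq> 0" for u w :: "'a fract"
    unfolding homeomorphic_map_maps
  proof (intro exI)
    have iw: "1 / w \<noteq> 0" using w by simp
    have backward: "rhat_act (- u / w, 1 / w) (rhat_act (u, w) x) = x" if "x \<in> rhat" for x
      using rhat_act_compose[OF iw w that] rhat_act_one[OF that] w by simp
    have forward: "rhat_act (u, w) (rhat_act (- u / w, 1 / w) x) = x" if "x \<in> rhat" for x
      using rhat_act_compose[OF w iw that] rhat_act_one[OF that] w by simp
    show "homeomorphic_maps (subtopology rhat_top (rhat_dom (- u / w, 1 / w)))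
      (subtopology rhat_top (rhat_dom (u, w))) (rhat_act (u, w)) (rhat_act (- u / w, 1 / w))"
      using continuous_rhat_act[OF w, of u] continuous_rhat_act[OF iw, of "- u / w"] w backward forward
      by (auto simp: homeomorphic_maps_def topspace_rhat_top)
  qed
  have comp: "x \<in> rhat_dom (- (u1 + u2 * w1) / (w1 * w2), 1 / (w1 * w2)) \<and>
      rhat_act (u1, w1) (rhat_act (u2, w2) x) = rhat_act (u1 + u2 * w1, w1 * w2) x"
    if w: "w1 \<noteq> 0" "w2 \<noteq> 0" and x: "x \<in> rhat_dom (- u2 / w2, 1 / w2)"
      and y: "rhat_act (u2, w2) x \<in> rhat_dom (- u1 / w1, 1 / w1)"
    for u1 u2 w1 w2 :: "'a fract" and x
  proof -
    have xr: "x \<in> rhat" using x by (simp add: rhat_dom_def)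
    have nz: "1 / (w1 * w2) \<noteq> 0" using w by simp
    have iw: "inverse w2 * (1 / w1) = 1 / (w1 * w2)" using w by (simp add: field_simps)
    obtain c where c: "x (1 / (w1 * w2)) = frac_coset c (1 / (w1 * w2))"
      using rhatD(1)[OF xr nz] by blast
    have "frac_coset (u2 + w2 * c) (1 / w1) = frac_coset (- u1 / w1) (1 / w1)"
      using rhat_act_apply[of w2 "1 / w1" x c u2] w c y unfolding iw by (simp add: rhat_dom_def)
    then have "u2 + w2 * c - - u1 / w1 \<in> frac_ideal (1 / w1)" by (simp add: frac_coset_eq_iff)
    moreover have "u2 + w2 * c - - u1 / w1 = w2 * (c - - (u1 + u2 * w1) / (w1 * w2))"
      using w by (simp add: field_simps)
    ultimately have "c - - (u1 + u2 * w1) / (w1 * w2) \<in> frac_ideal (1 / (w1 * w2))"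
      using frac_ideal_mult[OF w(2), of _ "1 / w1"] unfolding iw by simp
    then have "x (1 / (w1 * w2)) = frac_coset (- (u1 + u2 * w1) / (w1 * w2)) (1 / (w1 * w2))"
      using c frac_coset_eq_iff by blast
    then show ?thesis using xr rhat_act_compose[OF w xr] by (simp add: rhat_dom_def)
  qed
  have opn: "openin rhat_top (rhat_dom g)" if "g \<in> carrier ?G" for g :: "'a fract \<times> 'a fract"
    using that openin_rhat_dom by (cases g) (simp add: car)
  have hom: "homeomorphic_map (subtopology rhat_top (rhat_dom (inv\<^bsub>?G\<^esub> g)))
      (subtopology rhat_top (rhat_dom g)) (rhat_act g)" if "g \<in> carrier ?G" for g
    using that homeo by (cases g) (simp add: car inv_affine_group)
  have cmp: "x \<in> rhat_dom (inv\<^bsub>?G\<^esub> (g \<otimes>\<^bsub>?G\<^esub> h)) \<and> rhat_act g (rhat_act h x) = rhat_act (g \<otimes>\<^bsub>?G\<^esub> h) x"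
    if h: "g \<in> carrier ?G" "h \<in> carrier ?G" "x \<in> rhat_dom (inv\<^bsub>?G\<^esub> h)"
      "rhat_act h x \<in> rhat_dom (inv\<^bsub>?G\<^esub> g)" for g h x
  proof -
    obtain u1 w1 u2 w2 where gh: "g = (u1, w1)" "h = (u2, w2)" by (cases g, cases h)
    then have w: "w1 \<noteq> 0" "w2 \<noteq> 0" using h car by auto
    then have "w1 * w2 \<noteq> 0" by simp
    show ?thesis
      using comp[OF w, of x u2 u1] h(3,4)
      unfolding gh mul inv_affine_group[OF w(1)] inv_affine_group[OF w(2)]
        inv_affine_group[OF \<open>w1 * w2 \<noteq> 0\<close>] by blast
  qed
  show ?thesis
    unfolding partial_action_def one dom1 topspace_rhat_top
    using group_affine_group opn hom cmp rhat_act_one by blast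
qed

end

theory Submission
  imports Defs
begin

text \<open>
  Translations by elements of \<open>R\<close> alone already act minimally.  They are defined on the whole
  space, because the coordinate at \<open>1\<close> of every point is the coset \<open>(1) = R\<close>.  By directedness of \<open>\<le>\<close>, the sets
  prescribing one single coordinate form a neighbourhood base (\<open>open_contains_coordinate_cylinder\<close>).
  Now let \<open>V\<close> be open and invariant, let \<open>y \<in> V\<close>, and let \<open>t\<close> be such that every point with the same
  \<open>t\<close>-coordinate as \<open>y\<close> lies in \<open>V\<close>.  Every coordinate of a point is represented by an element of
  \<open>R\<close>, so for any \<open>x\<close> some translation by an element of \<open>R\<close> moves \<open>x\<^sub>t\<close> to \<open>y\<^sub>t\<close>, and hence \<open>x\<close> into
  \<open>V\<close>; the inverse translation and invariance bring \<open>x\<close> back into \<open>V\<close>.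
\<close>

lemma div_le_trans:
  assumes "div_le a b" "div_le b c"
  shows "div_le a c"
  using assms base_ring_closed(4) unfolding div_le_def by (metis mult.assoc)

lemma finite_div_le_upper_bound:
  assumes "finite F" "0 \<notin> F"
  shows "\<exists>t. t \<noteq> 0 \<and> (\<forall>w\<in>F. div_le w t)"
  using assms
proof (induction F rule: finite_induct)
  case empty
  show ?case by (intro exI[of _ 1]) simp
next
  case (insert w F)
  then obtain s where s: "s \<noteq> 0" "\<forall>v\<in>F. div_le v s" by auto
  obtain t where "t \<noteq> 0" "div_le w t" "div_le s t"
    using div_le_directed[of w s] s(1) insert.prems by auto
  then show ?case using s(2) div_le_trans by (intro exI[of _ t]) blast
qed

text \<open>A coordinate of a point determines all coordinates below it, so the finitely many coordinates
  restricted by a basic open set can be replaced by a common upper bound.\<close>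

lemma open_contains_coordinate_cylinder:
  assumes V: "openin rhat_top V" and y: "y \<in> V"
  obtains t where "t \<noteq> 0" "\<And>z. z \<in> rhat \<Longrightarrow> z t = y t \<Longrightarrow> z \<in> V"
proof -
  obtain S where S: "openin (product_topology (\<lambda>w. discrete_topology (frac_quot w)) units_of_field) S"
    and VS: "V = S \<inter> rhat"
    using V unfolding rhat_top_def openin_subtopology by blast
  have yr: "y \<in> rhat" and yS: "y \<in> S" using y VS by auto
  obtain U where U: "finite {w \<in> units_of_field. U w \<noteq> frac_quot w}"
      "y \<in> Pi\<^sub>E units_of_field U" "Pi\<^sub>E units_of_field U \<subseteq> S"
    using bspec[OF S[unfolded openin_product_topology_alt topspace_discrete_topology] yS]
    by (elim exE conjE)
  obtain t where t: "t \<noteq> 0" "\<forall>w\<in>{w \<in> units_of_field. U w \<noteq> frac_quot w}. div_le w t"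
    using finite_div_le_upper_bound[OF U(1)] by auto
  have "z \<in> V" if z: "z \<in> rhat" "z t = y t" for z
  proof -
    have "z w \<in> U w" if w: "w \<noteq> 0" for w
    proof (cases "U w = frac_quot w")
      case True
      then show ?thesis using z(1) w by (auto simp: rhat_def PiE_iff)
    next
      case False
      then have wt: "div_le w t" using t(2) w by auto
      obtain r where r: "y t = frac_coset r t" using rhatD(1)[OF yr t(1)] by blast
      have "z w = y w"
        using rhatD(2)[OF z(1) w t(1) wt] rhatD(2)[OF yr w t(1) wt] r z(2) by metis
      then show ?thesis using U(2) w by (auto simp: PiE_iff)
    qed
    then have "z \<in> Pi\<^sub>E units_of_field U"
      using z(1) by (auto simp: rhat_def PiE_iff)
    then show ?thesis using U(3) VS z(1) by blast
  qed
  then show ?thesis using that t(1) by blast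
qed

text \<open>Modulo \<open>(1) = R\<close>, all elements of \<open>R\<close> represent the same coset, namely the only one available.\<close>

lemma rhat_dom_translation:
  assumes "u \<in> base_ring"
  shows "rhat_dom (u, 1) = rhat"
proof -
  have "x 1 = frac_coset u 1" if x: "x \<in> rhat" for x
  proof -
    obtain r where "r \<in> base_ring" "x 1 = frac_coset r 1"
      using rhatD(1)[OF x, of 1] by auto
    then show ?thesis
      using base_ring_closed(6)[OF _ assms] by (auto simp: frac_coset_eq_iff frac_ideal_def)
  qed
  then show ?thesis by (auto simp: rhat_dom_def)
qed

theorem proposition4p6:
  assumes "\<And>m::'a::idom. m \<noteq> 0 \<Longrightarrow> finite (UNIV // {(a, b). m dvd a - b})"
  shows "pa_minimal (affine_group :: ('a fract \<times> 'a fract) monoid) rhat_top rhat_dom rhat_act"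
  unfolding pa_minimal_def
proof (intro allI impI)
  let ?G = "affine_group :: ('a fract \<times> 'a fract) monoid"
  fix V :: "('a fract \<Rightarrow> 'a fract set) set"
  assume "openin rhat_top V \<and> pa_invariant ?G rhat_dom rhat_act V"
  then have opn: "openin rhat_top V" and inv: "pa_invariant ?G rhat_dom rhat_act V" by auto
  have Vr: "V \<subseteq> rhat" using openin_subset[OF opn] by (simp add: topspace_rhat_top)
  have "rhat \<subseteq> V" if ne: "V \<noteq> {}"
  proof
    fix x :: "'a fract \<Rightarrow> 'a fract set" assume x: "x \<in> rhat"
    obtain y where y: "y \<in> V" using ne by blast
    obtain t where t: "t \<noteq> 0" "\<And>z. z \<in> rhat \<Longrightarrow> z t = y t \<Longrightarrow> z \<in> V"
      using open_contains_coordinate_cylinder[OF opn y] by blast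
    obtain r where r: "r \<in> base_ring" "y t = frac_coset r t"
      using rhatD(1)[OF subsetD[OF Vr y] t(1)] by blast
    obtain c where c: "c \<in> base_ring" "x t = frac_coset c t"
      using rhatD(1)[OF x t(1)] by blast
    define u where "u = r - c"
    have u: "u \<in> base_ring" "- u \<in> base_ring"
      using r(1) c(1) base_ring_closed(5,6) by (auto simp: u_def)
    define z where "z = rhat_act (u, 1) x"
    have "z \<in> rhat_dom (u, 1)"
      unfolding z_def using rhat_act_mem[of 1 x u] x rhat_dom_translation[OF u(2)] by simp
    then have zr: "z \<in> rhat" by (simp add: rhat_dom_def)
    have "z t = y t"
      unfolding z_def using rhat_act_apply[of 1 t x c u] t(1) c(2) r(2) by (simp add: u_def)
    then have "z \<in> V" using t(2) zr by blast
    moreover have "z \<in> rhat_dom (inv\<^bsub>?G\<^esub> (- u, 1))"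
      using zr rhat_dom_translation[OF u(1)] by (simp add: inv_affine_group)
    moreover have "(- u, 1) \<in> carrier ?G" by (simp add: affine_group_def)
    ultimately have "rhat_act (- u, 1) z \<in> V"
      using inv unfolding pa_invariant_def by blast
    moreover have "rhat_act (- u, 1) z = x"
      unfolding z_def using rhat_act_compose[of 1 1 x "- u" u] rhat_act_one[OF x] x by simp
    ultimately show "x \<in> V" by simp
  qed
  then show "V = {} \<or> V = topspace rhat_top"
    using Vr by (auto simp: topspace_rhat_top)
qed

end
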